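(* For every integer $n\ge 0$, the number $f_{0,0}(n,2)$ of paths of length $n$ from $(0,0)$ to $(0,0)$ in the directed graph $D_2$ is $$f_{0,0}(n,2)=\begin{cases}\mathrm{Fib}_{n-1} & \text{if } 3\mid n,\\ 0 & \text{otherwise,}\end{cases}$$ where $\mathrm{Fib}_m$ denotes the $m$-th Fibonacci number.
   Context: The directed graph $D_2$ has vertex set $V_2=\{(i,j): i,j\in\mathbb{Z}_{\ge 0},\ i+j\le 2\}$. There is a directed edge from $(a,b)\in V_2$ to $(c,d)\in V_2$ exactly when $(c,d)$ is one of $(a,b+1)$, $(a-1,b)$, $(a+1,b-1)$. A path of length $n$ is a sequence of vertices $v_0,v_1,\ldots,v_n$ such that $(v_{l},v_{l+1})$ is a directed edge for each $0\le l<n$; vertices may repeat. Fibonacci numbers are normalized by $\mathrm{Fib}_0=0$, $\mathrm{Fib}_1=1$, $\mathrm{Fib}_{m+1}=\mathrm{Fib}_m+\mathrm{Fib}_{m-1}$, extended to $m=-1$ by the same recurrence, so $\mathrm{Fib}_{-1}=1$. *)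

theory Defs
  imports "Graph_Theory.Graph_Theory" "HOL-Number_Theory.Fib"
begin

(* Coordinates are integers, not natural numbers: truncated subtraction would turn the
   edge (a, b) -> (a - 1, b) into a loop at a = 0. *)

definition V2 :: "(int \<times> int) set" where
  "V2 = {(i, j). 0 \<le> i \<and> 0 \<le> j \<and> i + j \<le> 2}"

definition D2 :: "(int \<times> int) pair_pre_digraph" where
  "D2 = \<lparr> pverts = V2,
          parcs = {((a, b), (c, d)). (a, b) \<in> V2 \<and> (c, d) \<in> V2 \<and>
                     ((c, d) = (a, b + 1) \<or> (c, d) = (a - 1, b) \<or> (c, d) = (a + 1, b - 1))} \<rparr>"

lemma finite_V2: "finite V2"
proof (rule finite_subset)
  show "V2 \<subseteq> {0..2} \<times> {0..2}" by (auto simp: V2_def)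
qed simp

lemma wf_digraph_D2: "wf_digraph (with_proj D2)"
  by unfold_locales (auto simp: D2_def)

(* A path in the sense used here may repeat vertices: it is a \<^const>\<open>vwalk\<close>, not a
   \<^const>\<open>vpath\<close>. Its length is the number of edges, so the list has n + 1 entries. *)

definition paths :: "('a, 'b) pre_digraph \<Rightarrow> nat \<Rightarrow> 'a \<Rightarrow> 'a \<Rightarrow> 'a vwalk set" where
  "paths G n u v = {p. vwalk p G \<and> hd p = u \<and> last p = v \<and> vwalk_length p = n}"

(* So that \<^const>\<open>card\<close> really counts. *)
lemma finite_paths:
  assumes "finite (verts G)"
  shows "finite (paths G n u v)"
proof (rule finite_subset)
  show "paths G n u v \<subseteq> {p. set p \<subseteq> verts G \<and> length p \<le> Suc n}"
    by (auto simp: paths_def vwalk_def)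
  show "finite {p. set p \<subseteq> verts G \<and> length p \<le> Suc n}"
    by (rule finite_lists_length_le[OF assms])
qed

definition num_paths :: "('a, 'b) pre_digraph \<Rightarrow> nat \<Rightarrow> 'a \<Rightarrow> 'a \<Rightarrow> nat" where
  "num_paths G n u v = card (paths G n u v)"

(* Fibonacci numbers with index extended to -1 (the values below -1 are irrelevant). *)
definition Fib :: "int \<Rightarrow> nat" where
  "Fib m = (if m = -1 then 1 else fib (nat m))"

lemma Fib_rec:
  assumes "0 \<le> m"
  shows "Fib (m + 1) = Fib m + Fib (m - 1)"
proof (cases "m = 0")
  case False
  with assms obtain k where "m = int (Suc k)"
    by (metis gr0_implies_Suc nonneg_int_cases of_nat_0 neq0_conv)
  moreover from this have "nat (m + 1) = Suc (Suc k)" "nat m = Suc k" "nat (m - 1) = k"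
    by linarith+
  ultimately show ?thesis by (simp add: Fib_def)
qed (simp add: Fib_def)

end

theory Submission
  imports Defs
begin

text \<open>
  The map \<open>(a, b) \<mapsto> (2 - a - b, a)\<close> rotates the triangle \<^const>\<open>V2\<close> by a third of a turn and
  preserves the edges. Modulo this symmetry two vertices are left, the corner and the midpoint of a
  side: a corner has one successor, a midpoint, while a midpoint has two, one corner and one
  midpoint. The adjacency matrix of this quotient is the Fibonacci matrix, so it has
  \<open>Fib (n - 1)\<close> walks of length \<open>n\<close> from the corner to the corner, and \<open>Fib n\<close> from the
  midpoint to the corner.

  What the quotient forgets is which of the three corners a walk reaches. Every edge changes
  \<open>a - b\<close> by \<open>-1\<close> modulo 3, and \<open>a - b\<close> takes each residue at exactly one corner. Hence the
  starting point and the length of a walk that ends in a corner determine that corner: the walks of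
  \<^const>\<open>D2\<close> from \<open>(a, b)\<close> to \<open>(0, 0)\<close> are all the walks of the quotient if
  \<open>a - b \<equiv> n\<close> modulo 3, and there are none otherwise. The lemma \<open>num_paths_D2_origin\<close> is this
  count, proved by splitting off the first step of a walk.
\<close>

lemma paths_0: "paths G 0 u v = (if u = v \<and> u \<in> verts G then {[u]} else {})"
proof -
  have "p \<in> paths G 0 u v \<longleftrightarrow> p = [u] \<and> u = v \<and> u \<in> verts G" for p
    by (cases p) (auto simp: paths_def vwalk_def vwalk_length_def)
  then show ?thesis by auto
qed

lemma paths_Suc:
  assumes "wf_digraph G"
  shows "paths G (Suc n) u v = (\<Union>w\<in>{w. u \<rightarrow>\<^bsub>G\<^esub> w}. (#) u ` paths G n w v)"
proof (intro set_eqI iffI)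
  fix p
  assume p: "p \<in> paths G (Suc n) u v"
  then obtain w q where "p = u # w # q"
    by (cases p rule: vwalk_arcs.cases) (auto simp: paths_def vwalk_length_def)
  with p show "p \<in> (\<Union>w\<in>{w. u \<rightarrow>\<^bsub>G\<^esub> w}. (#) u ` paths G n w v)"
    by (auto simp: paths_def vwalk_def vwalk_length_def intro!: exI[of _ w])
next
  fix p
  assume "p \<in> (\<Union>w\<in>{w. u \<rightarrow>\<^bsub>G\<^esub> w}. (#) u ` paths G n w v)"
  then obtain w q where "u \<rightarrow>\<^bsub>G\<^esub> w" "p = u # q" "q \<in> paths G n w v" by auto
  moreover from this obtain r where "q = w # r"
    by (cases q) (auto simp: paths_def vwalk_def)
  ultimately show "p \<in> paths G (Suc n) u v"
    using wf_digraph.adj_in_verts(1)[OF assms]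
    by (auto simp: paths_def vwalk_def vwalk_length_def)
qed

lemma num_paths_Suc:
  assumes "wf_digraph G" "finite (verts G)"
  shows "num_paths G (Suc n) u v = (\<Sum>w | u \<rightarrow>\<^bsub>G\<^esub> w. num_paths G n w v)"
proof -
  have fin: "finite {w. u \<rightarrow>\<^bsub>G\<^esub> w}"
    using wf_digraph.adj_in_verts(2)[OF assms(1)] assms(2)
    by (auto intro: finite_subset)
  have disj: "(#) u ` paths G n w v \<inter> (#) u ` paths G n w' v = {}" if "w \<noteq> w'" for w w'
    using that by (auto simp: paths_def)
  show ?thesis
    unfolding num_paths_def paths_Suc[OF assms(1)]
    by (subst card_UN_disjoint)
      (use fin disj assms(2) in \<open>auto simp: finite_paths card_image\<close>)
qed

lemma V2_eq: "V2 = {(0, 0), (0, 1), (0, 2), (1, 0), (1, 1), (2, 0)}"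
proof
  show "V2 \<subseteq> {(0, 0), (0, 1), (0, 2), (1, 0), (1, 1), (2, 0)}"
  proof
    fix u
    assume "u \<in> V2"
    then obtain i j where u: "u = (i, j)" and ij: "0 \<le> i" "0 \<le> j" "i + j \<le> 2"
      by (auto simp: V2_def)
    from ij have "i = 0 \<or> i = 1 \<or> i = 2" "j = 0 \<or> j = 1 \<or> j = 2" by linarith+
    with ij show "u \<in> {(0, 0), (0, 1), (0, 2), (1, 0), (1, 1), (2, 0)}"
      by (auto simp: u)
  qed
qed (simp add: V2_def)

lemma D2_successors:
  "{w. (0, 0) \<rightarrow>\<^bsub>with_proj D2\<^esub> w} = {(0, 1)}"
  "{w. (0, 1) \<rightarrow>\<^bsub>with_proj D2\<^esub> w} = {(0, 2), (1, 0)}"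
  "{w. (0, 2) \<rightarrow>\<^bsub>with_proj D2\<^esub> w} = {(1, 1)}"
  "{w. (1, 0) \<rightarrow>\<^bsub>with_proj D2\<^esub> w} = {(0, 0), (1, 1)}"
  "{w. (1, 1) \<rightarrow>\<^bsub>with_proj D2\<^esub> w} = {(0, 1), (2, 0)}"
  "{w. (2, 0) \<rightarrow>\<^bsub>with_proj D2\<^esub> w} = {(1, 0)}"
  by (auto simp: D2_def V2_eq)

text \<open>
  The start must vary for the induction, which is why all six vertices are treated together. At
  \<open>n = 0\<close> the congruence singles out both \<open>(0, 0)\<close> and \<open>(1, 1)\<close>, and the values there
  come out right because \<open>Fib (-1) = 1\<close> and \<open>Fib 0 = 0\<close>.
\<close>

lemma num_paths_D2_origin:
  assumes "(a, b) \<in> V2"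
  shows "num_paths (with_proj D2) n (a, b) (0, 0) =
    (if 3 dvd int n - (a - b)
     then if (a, b) \<in> {(0, 0), (0, 2), (2, 0)} then Fib (int n - 1) else Fib (int n)
     else 0)"
  using assms
proof (induction n arbitrary: a b)
  case 0
  then show ?case
    by (auto simp: num_paths_def paths_0 D2_def V2_eq Fib_def)
next
  case (Suc n)
  have first_step: "num_paths (with_proj D2) (Suc n) u (0, 0) =
      (\<Sum>w | u \<rightarrow>\<^bsub>with_proj D2\<^esub> w. num_paths (with_proj D2) n w (0, 0))" for u
    by (rule num_paths_Suc[OF wf_digraph_D2]) (simp add: D2_def finite_V2)
  (* The successor sets are substituted here because simp would rewrite the arc relation below the
     sum into membership in parcs D2, to which D2_successors no longer applies. *)
  note steps = D2_successors[THEN arg_cong, of "sum (\<lambda>w. num_paths (with_proj D2) n w (0, 0))",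
      folded first_step]
  have rec: "Fib (1 + int n) = Fib (int n) + Fib (int n - 1)"
    using Fib_rec[of "int n"] by (simp add: add.commute)
  have residues: "3 dvd 1 + int n \<longleftrightarrow> 3 dvd int n - 2" "3 dvd int n + 2 \<longleftrightarrow> 3 dvd int n - 1"
    by presburger+
  from Suc.prems show ?case
    unfolding V2_eq
    by (auto simp: steps Suc.IH V2_eq rec residues algebra_simps)
qed

theorem mainTheorem4:
  fixes n :: nat
  shows "num_paths (with_proj D2) n (0, 0) (0, 0) = (if 3 dvd n then Fib (int n - 1) else 0)"
proof -
  have "3 dvd int n \<longleftrightarrow> 3 dvd n" by presburger
  then show ?thesis by (simp add: num_paths_D2_origin V2_eq)
qed

end
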